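(* Let $\bar\alpha=(\alpha_1,\alpha_2,\alpha_3)\in\mathbb N_0^3$ and $\gamma=(\gamma_1,\gamma_2,\gamma_3)\in\mathbb N_0^3$ be such that $\mathcal B_\gamma^{\bar\alpha}$ is finite, and assume $\gamma_j\ge1$ for $j=1,2,3$. Let $k\in\{1,2,3\}$ with $\delta_k>0$, where $\delta_j=\alpha_j+1-\gamma_j$ and $|\delta|=\delta_1+\delta_2+\delta_3$. Then $$\mathcal B_\gamma^{\bar\alpha}=\frac{\alpha_k}{|\delta|}\,\mathcal B_\gamma^{\bar\alpha-\mathbf e_k}-\frac{\gamma_k}{|\delta|}\,\mathcal B_{\gamma+\mathbf e_k}^{\bar\alpha},$$ and both moments on the right-hand side are finite.
   Context: Let $T\subset\mathbb R^3$ be a tetrahedron with barycentric coordinates $\lambda_0,\dots,\lambda_3$. For $\bar\alpha,\gamma\in\mathbb N_0^3$, $$\mathcal B_\gamma^{\bar\alpha}=|T|^{-1}\int_T\frac{\lambda_1^{\alpha_1}\lambda_2^{\alpha_2}\lambda_3^{\alpha_3}}{(\lambda_0+\lambda_1)^{\gamma_1}(\lambda_0+\lambda_2)^{\gamma_2}(\lambda_0+\lambda_3)^{\gamma_3}}\,\mathrm dx\in[0,\infty].$$ It is finite if and only if $\gamma_j\le\alpha_j+1$ for $j=1,2,3$, so that $\delta_j\in\mathbb N_0$ in the finite case. $\mathbf e_k$ is the $k$-th canonical unit vector of $\mathbb N_0^3$. *)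

theory Defs
  imports "HOL-Analysis.Analysis"
begin

text \<open>
  A tetrahedron is given by its vertices \<open>v 0, v 1, v 2, v 3\<close>, indexed by the four-element type
  \<open>4\<close>; it is nondegenerate if \<open>v\<close> is injective with affinely independent range.  Multi-indices are
  vectors of type \<open>nat ^ 3\<close>; the elements of the index type \<open>3\<close> are \<open>1, 2, 3\<close> (with \<open>3 = 0\<close>),
  and the unit vector \<open>e\<^sub>k\<close> is \<open>axis k 1\<close>.
\<close>

definition tetrahedron :: "(4 \<Rightarrow> real ^ 3) \<Rightarrow> (real ^ 3) set"
  where "tetrahedron v = convex hull (range v)"

text \<open>
  The coordinates of \<open>x\<close> exist and are unique for every \<open>x\<close> if the tetrahedron is nondegenerate.
\<close>

definition barycentric :: "(4 \<Rightarrow> real ^ 3) \<Rightarrow> real ^ 3 \<Rightarrow> 4 \<Rightarrow> real"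
  where "barycentric v x =
    (THE l. (\<Sum>i\<in>UNIV. l i) = 1 \<and> (\<Sum>i\<in>UNIV. l i *\<^sub>R v i) = x)"

definition moment_integrand :: "nat ^ 3 \<Rightarrow> nat ^ 3 \<Rightarrow> (4 \<Rightarrow> real) \<Rightarrow> real"
  where "moment_integrand \<alpha> \<gamma> l =
    (l 1 ^ (\<alpha> $ 1) * l 2 ^ (\<alpha> $ 2) * l 3 ^ (\<alpha> $ 3)) /
    ((l 0 + l 1) ^ (\<gamma> $ 1) * (l 0 + l 2) ^ (\<gamma> $ 2) * (l 0 + l 3) ^ (\<gamma> $ 3))"

text \<open>
  The moment takes values in \<open>[0, \<infinity>]\<close>.  The integrand is nonnegative on the tetrahedron, and its
  denominator vanishes at most on three edges, a null set, so that the convention \<open>x / 0 = 0\<close>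
  there does not affect the integral.
\<close>

definition moment :: "(4 \<Rightarrow> real ^ 3) \<Rightarrow> nat ^ 3 \<Rightarrow> nat ^ 3 \<Rightarrow> ennreal"
  where "moment v \<alpha> \<gamma> =
    inverse (emeasure lborel (tetrahedron v)) *
    (\<integral>\<^sup>+x\<in>tetrahedron v. ennreal (moment_integrand \<alpha> \<gamma> (barycentric v x)) \<partial>lborel)"

text \<open>Integer-valued, since \<open>\<gamma> $ j > \<alpha> $ j + 1\<close> is possible when the moment is infinite.\<close>

definition delta :: "nat ^ 3 \<Rightarrow> nat ^ 3 \<Rightarrow> int ^ 3"
  where "delta \<alpha> \<gamma> = (\<chi> j. int (\<alpha> $ j) + 1 - int (\<gamma> $ j))"

definition delta_sum :: "nat ^ 3 \<Rightarrow> nat ^ 3 \<Rightarrow> int"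
  where "delta_sum \<alpha> \<gamma> = (\<Sum>j\<in>UNIV. delta \<alpha> \<gamma> $ j)"

end

theory Submission imports Defs
begin

text \<open>
  The recursion is integration by parts along the segments from the vertex \<open>k\<close> to the opposite face.
  Let \<open>f\<close> be the integrand, regarded as a function of four independent variables \<open>\<lambda>\<^sub>0, \<dots>, \<lambda>\<^sub>3\<close>.  It is
  homogeneous of degree \<open>|\<delta>| - 3\<close>, and its partial derivative \<open>\<partial>\<^sub>k f\<close> is \<open>\<alpha>\<^sub>k f / \<lambda>\<^sub>k - \<gamma>\<^sub>k f / (\<lambda>\<^sub>0 + \<lambda>\<^sub>k)\<close>, the
  integrand of \<open>\<alpha>\<^sub>k\<close> times the first moment on the right minus \<open>\<gamma>\<^sub>k\<close> times the second.  By Euler's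
  identity, the vector field \<open>f \<cdot> (e\<^sub>k - \<lambda>)\<close> in the tetrahedron has divergence \<open>\<partial>\<^sub>k f - |\<delta>| f\<close>.
  It is tangent to the three faces through the vertex \<open>k\<close>, and it vanishes on the face
  \<open>\<lambda>\<^sub>k = 0\<close>, since \<open>\<alpha>\<^sub>k \<ge> \<gamma>\<^sub>k \<ge> 1\<close>.  Hence \<open>|\<delta>|\<close> times the integral of \<open>f\<close> equals the integral of \<open>\<partial>\<^sub>k f\<close>.

  The integrand is singular on edges, so the divergence theorem is replaced by an explicit
  computation.  Let \<open>i, j\<close> be the other two positive indices.  In the coordinates \<open>\<lambda>\<^sub>0 = x\<close>, \<open>\<lambda>\<^sub>i = x u\<close>,
  \<open>\<lambda>\<^sub>j = x w\<close>, \<open>\<lambda>\<^sub>k = 1 - (u + w + 1) x\<close>, the integrand is, on each ray of fixed \<open>u, w\<close>, a product of powers of linear functions of \<open>x\<close>,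
  without singularities once the Jacobian is included; the fundamental theorem of calculus gives the
  identity on each ray (\<open>nn_integral_ray_by_parts\<close>), and Tonelli's theorem puts the rays together
  (\<open>simplex_integral_by_parts\<close>).  All terms are kept nonnegative, so the identity
  \<open>|\<delta>| B + \<gamma>\<^sub>k B' = \<alpha>\<^sub>k B''\<close> holds in \<open>[0, \<infinity>]\<close> (\<open>moment_by_parts\<close>), where
  \<open>B\<close> is the given moment, \<open>B'\<close> has \<open>\<gamma>\<^sub>k\<close> raised by one, and \<open>B''\<close> has \<open>\<alpha>\<^sub>k\<close> lowered by one.

  To subtract, one needs finiteness, which comes from the criterion \<open>\<gamma>\<^sub>j \<le> \<alpha>\<^sub>j + 1\<close> for all \<open>j\<close>.  It is
  necessary (\<open>moment_infinite\<close>), for if it fails for some \<open>j\<close>, the integrand is at least of order \<open>x\<^sup>-\<^sup>2\<close> in a wedge of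
  width \<open>x\<close> at the edge \<open>\<lambda>\<^sub>0 = \<lambda>\<^sub>j = 0\<close>.  So it holds for the given exponents, and as \<open>\<delta>\<^sub>k > 0\<close> it
  still holds after \<open>\<alpha>\<^sub>k\<close> is lowered by one.  It is sufficient (\<open>moment_finite\<close>), because the
  integrand is then dominated by sums of products \<open>1 / ((\<lambda>\<^sub>0 + \<lambda>\<^sub>i) (\<lambda>\<^sub>0 + \<lambda>\<^sub>j))\<close>, and these are
  integrable.  Thus \<open>B''\<close> is finite, and so is \<open>B'\<close> by the identity, since \<open>\<gamma>\<^sub>k \<ge> 1\<close>.
\<close>

section \<open>Change of variables in Euclidean space\<close>

text \<open>
  The factor \<open>c\<close> is \<open>\<bar>det f\<bar>\<close>.  It suffices to compare the two measures on boxes, whose preimages have a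
  volume given by the determinant.
\<close>

lemma nn_integral_linear_substitution:
  fixes f :: "real^'n::{finite,wellorder} \<Rightarrow> real^'n::_"
  assumes f: "linear f" "inj f"
  shows "\<exists>c::real. c > 0 \<and> (\<forall>h\<in>borel_measurable borel. \<forall>t.
     (\<integral>\<^sup>+x. h x \<partial>lborel) = ennreal c * (\<integral>\<^sup>+x. h (t + f x) \<partial>lborel))"
proof -
  define c where "c = \<bar>det (matrix f)\<bar>"
  from f have c: "c > 0"
    by (simp add: c_def det_nz_iff_inj)
  have sf: "surj f"
    using f by (simp add: linear_injective_imp_surjective)
  have [measurable]: "f \<in> borel_measurable borel"
    using f(1) by (intro borel_measurable_continuous_onI linear_continuous_on linear_conv_bounded_linear[THEN iffD1])
  have *: "lborel = density (distr lborel borel (\<lambda>x. t + f x)) (\<lambda>_. ennreal c)" for t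
  proof (rule lborel_eqI)
    fix l u :: "real^'n::{finite,wellorder}" assume le: "\<And>b. b \<in> Basis \<Longrightarrow> l \<bullet> b \<le> u \<bullet> b"
    let ?g = "inv f"
    let ?S = "(\<lambda>x. t + f x) -` box l u"
    have S: "f ` ?S = box (l - t) (u - t)"
    proof (intro set_eqI iffI)
      fix y assume "y \<in> box (l - t) (u - t)"
      moreover obtain x where "y = f x" using sf by (metis surjD)
      ultimately show "y \<in> f ` ?S" by (auto simp: box_def inner_simps algebra_simps)
    qed (auto simp: box_def inner_simps algebra_simps)
    have "linear ?g" using f by (simp add: linear_injective_isomorphism inj_linear_imp_inv_linear)
    moreover have "?S = ?g ` box (l - t) (u - t)"
      unfolding S[symmetric] using f(2) by (simp add: image_comp)
    ultimately have Sm: "?S \<in> lmeasurable"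
      by (simp add: measurable_linear_image)
    have [measurable]: "?S \<in> sets borel"
      by (rule measurable_sets_borel[of _ borel]) auto
    have "emeasure lborel (box (l - t) (u - t)) = ennreal (measure lebesgue (f ` ?S))"
      unfolding S using emeasure_lborel_box_finite[of "l - t" "u - t"]
      by (simp add: emeasure_eq_ennreal_measure)
    also have "\<dots> = ennreal c * ennreal (measure lebesgue ?S)"
      using measure_linear_image[OF f(1) Sm] by (simp add: c_def ennreal_mult)
    also have "ennreal (measure lebesgue ?S) = emeasure lborel ?S"
      using fmeasurableD2[OF Sm]
      by (subst emeasure_eq_ennreal_measure[symmetric]) (simp_all add: less_top[symmetric])
    finally have eq: "ennreal c * emeasure lborel ?S = emeasure lborel (box (l - t) (u - t))" ..
    have "emeasure (density (distr lborel borel (\<lambda>x. t + f x)) (\<lambda>_. ennreal c)) (box l u)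
       = ennreal c * emeasure lborel ?S"
      by (subst emeasure_density_const) (auto simp: emeasure_distr)
    also have "\<dots> = (\<Prod>b\<in>Basis. (u - l) \<bullet> b)"
      unfolding eq using le by (subst emeasure_lborel_box) (auto simp: inner_simps)
    finally show "emeasure (density (distr lborel borel (\<lambda>x. t + f x)) (\<lambda>_. ennreal c)) (box l u) = \<dots>" .
  qed simp
  have "(\<integral>\<^sup>+x. h x \<partial>lborel) = ennreal c * (\<integral>\<^sup>+x. h (t + f x) \<partial>lborel)"
    if [measurable]: "h \<in> borel_measurable borel" for h t
    by (subst *[of t])
       (simp add: nn_integral_density nn_integral_distr nn_integral_cmult)
  with c show ?thesis by blast
qed

lemma nn_integral_iterated_3:
  fixes h :: "real^3 \<Rightarrow> ennreal"
  assumes [measurable]: "h \<in> borel_measurable borel"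
  shows "(\<integral>\<^sup>+w. h w \<partial>lborel) = (\<integral>\<^sup>+x. \<integral>\<^sup>+y. \<integral>\<^sup>+z. h (vector [x, y, z]) \<partial>lborel \<partial>lborel \<partial>lborel)"
proof -
  let ?v = "\<lambda>(x,y,z). vector [x, y, z] :: real^3"
  let ?P = "lborel \<Otimes>\<^sub>M (lborel \<Otimes>\<^sub>M lborel) :: (real \<times> real \<times> real) measure"
  have "continuous_on UNIV (\<lambda>p. ?v p $ i)" for i
    using exhaust_3[of i]
    by (elim disjE) (simp_all add: case_prod_beta continuous_on_fst continuous_on_snd continuous_on_id)
  then have "continuous_on UNIV (\<lambda>p. \<chi> i. ?v p $ i)"
    by (rule continuous_on_vec_lambda)
  then have "continuous_on UNIV ?v"
    by simp
  then have [measurable]: "?v \<in> ?P \<rightarrow>\<^sub>M borel"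
    by (simp add: lborel_prod borel_measurable_continuous_onI)
  have "lborel = distr ?P borel ?v"
  proof (rule lborel_eqI)
    fix l u :: "real^3" assume le: "\<And>b. b \<in> Basis \<Longrightarrow> l \<bullet> b \<le> u \<bullet> b"
    have B: "(Basis :: (real^3) set) = (\<lambda>i. axis i 1) ` UNIV"
      by (auto simp: Basis_vec_def)
    have le': "l $ i \<le> u $ i" for i
      using le[of "axis i 1"] by (simp add: inner_axis B)
    have "?v -` box l u = {l$1<..<u$1} \<times> ({l$2<..<u$2} \<times> {l$3<..<u$3})"
      by (auto simp: mem_box_cart forall_3)
    then have "emeasure (distr ?P borel ?v) (box l u)
      = emeasure ?P ({l$1<..<u$1} \<times> ({l$2<..<u$2} \<times> {l$3<..<u$3}))"
      by (simp add: emeasure_distr space_pair_measure)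
    also have "\<dots> = emeasure lborel {l$1<..<u$1}
        * emeasure (lborel \<Otimes>\<^sub>M lborel) ({l$2<..<u$2} \<times> {l$3<..<u$3})"
      unfolding lborel_prod
      by (subst lborel_prod[symmetric], rule lborel.emeasure_pair_measure_Times)
         (auto intro!: borel_open open_Times)
    also have "\<dots> = ennreal (u$1-l$1) * (ennreal (u$2-l$2) * ennreal (u$3-l$3))"
      by (simp add: lborel.emeasure_pair_measure_Times le')
    also have "\<dots> = (\<Prod>b\<in>Basis. (u - l) \<bullet> b)"
    proof -
      have "(\<Prod>b\<in>Basis. (u - l) \<bullet> b) = (\<Prod>i\<in>UNIV. u $ i - l $ i)"
        unfolding B by (subst prod.reindex) (simp_all add: inj_on_def axis_eq_axis inner_axis)
      also have "\<dots> = (u$1-l$1) * ((u$2-l$2) * (u$3-l$3))"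
        unfolding UNIV_3 by simp
      finally show ?thesis
        by (simp add: ennreal_mult le')
    qed
    finally show "emeasure (distr ?P borel ?v) (box l u) = \<dots>" .
  qed simp
  then have "(\<integral>\<^sup>+w. h w \<partial>lborel) = (\<integral>\<^sup>+w. h w \<partial>distr ?P borel ?v)" by simp
  also have "\<dots> = (\<integral>\<^sup>+p. h (?v p) \<partial>?P)"
    by (simp add: nn_integral_distr)
  also have "\<dots> = (\<integral>\<^sup>+x. \<integral>\<^sup>+p. h (?v (x, p)) \<partial>(lborel \<Otimes>\<^sub>M lborel) \<partial>lborel)"
    by (rule sigma_finite_measure.nn_integral_fst[symmetric])
       (simp add: lborel_prod sigma_finite_lborel, measurable)
  also have "\<dots> = (\<integral>\<^sup>+x. \<integral>\<^sup>+y. \<integral>\<^sup>+z. h (vector [x, y, z]) \<partial>lborel \<partial>lborel \<partial>lborel)"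
    by (subst lborel.nn_integral_fst[symmetric]) simp_all
  finally show ?thesis .
qed

section \<open>Barycentric coordinates and mean values over a tetrahedron\<close>

text \<open>
  The difference of two representations of a point, transported to the range of \<open>v\<close>, is an affine
  dependence of the vertices.
\<close>

lemma barycentric_coordinates_unique:
  fixes v :: "4 \<Rightarrow> real^3"
  assumes v: "inj v" "\<not> affine_dependent (range v)"
    and l: "(\<Sum>i\<in>UNIV. l i) = (\<Sum>i\<in>UNIV. m i)"
      "(\<Sum>i\<in>UNIV. l i *\<^sub>R v i) = (\<Sum>i\<in>UNIV. m i *\<^sub>R v i)"
  shows "l = m"
proof (rule ccontr)
  assume "l \<noteq> m"
  then obtain i where "l i \<noteq> m i" by auto
  let ?U = "\<lambda>w. l (inv v w) - m (inv v w)"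
  have "sum ?U (range v) = 0"
    using l(1) v(1) by (simp add: sum.reindex sum_subtractf)
  moreover have "(\<Sum>w\<in>range v. ?U w *\<^sub>R w) = 0"
    using l(2) v(1) by (simp add: sum.reindex sum_subtractf scaleR_left_diff_distrib)
  moreover have "?U (v i) \<noteq> 0"
    using v(1) \<open>l i \<noteq> m i\<close> by simp
  ultimately have "affine_dependent (range v)"
    by (subst affine_dependent_explicit_finite) (auto intro!: exI[of _ ?U])
  with v(2) show False ..
qed

lemma barycentric_eqI:
  assumes "inj v" "\<not> affine_dependent (range v)"
    and "(\<Sum>i\<in>UNIV. l i) = 1" "(\<Sum>i\<in>UNIV. l i *\<^sub>R v i) = x"
  shows "barycentric v x = l"
  unfolding barycentric_def
  using assms by (intro the_equality) (auto intro!: barycentric_coordinates_unique)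

lemma affine_combination_in_tetrahedron_iff:
  assumes v: "inj v" "\<not> affine_dependent (range v)" and l: "(\<Sum>i\<in>UNIV. l i) = 1"
  shows "(\<Sum>i\<in>UNIV. l i *\<^sub>R v i) \<in> tetrahedron v \<longleftrightarrow> (\<forall>i. 0 \<le> l i)"
proof -
  have "(\<Sum>i\<in>UNIV. l i *\<^sub>R v i) \<in> tetrahedron v \<longleftrightarrow> (\<exists>u. (\<forall>i. 0 \<le> u (v i)) \<and>
      (\<Sum>i\<in>UNIV. u (v i)) = 1 \<and> (\<Sum>i\<in>UNIV. u (v i) *\<^sub>R v i) = (\<Sum>i\<in>UNIV. l i *\<^sub>R v i))"
    using v(1) by (simp add: tetrahedron_def convex_hull_finite sum.reindex)
  also have "\<dots> \<longleftrightarrow> (\<forall>i. 0 \<le> l i)"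
  proof
    assume "\<exists>u. (\<forall>i. 0 \<le> u (v i)) \<and> (\<Sum>i\<in>UNIV. u (v i)) = 1 \<and>
      (\<Sum>i\<in>UNIV. u (v i) *\<^sub>R v i) = (\<Sum>i\<in>UNIV. l i *\<^sub>R v i)"
    then obtain u where u: "\<And>i. 0 \<le> u (v i)" "(\<Sum>i\<in>UNIV. u (v i)) = 1"
      "(\<Sum>i\<in>UNIV. u (v i) *\<^sub>R v i) = (\<Sum>i\<in>UNIV. l i *\<^sub>R v i)" by blast
    have "(\<lambda>i. u (v i)) = l"
      using v u l by (intro barycentric_coordinates_unique) auto
    with u(1) show "\<forall>i. 0 \<le> l i" by auto
  next
    assume "\<forall>i. 0 \<le> l i"
    with v(1) l show "\<exists>u. (\<forall>i. 0 \<le> u (v i)) \<and> (\<Sum>i\<in>UNIV. u (v i)) = 1 \<and>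
      (\<Sum>i\<in>UNIV. u (v i) *\<^sub>R v i) = (\<Sum>i\<in>UNIV. l i *\<^sub>R v i)"
      by (intro exI[of _ "\<lambda>w. l (inv v w)"]) simp
  qed
  finally show ?thesis .
qed

text \<open>
  Points of the tetrahedron are parametrised by three barycentric coordinates \<open>x, y, z\<close>, belonging to
  the vertices \<open>q, r, s\<close>; the vertex \<open>p\<close> takes the remaining mass.  The labelling is kept variable,
  since each of the arguments below singles out different vertices.
\<close>

definition simplex_point :: "4 \<Rightarrow> 4 \<Rightarrow> 4 \<Rightarrow> 4 \<Rightarrow> real \<Rightarrow> real \<Rightarrow> real \<Rightarrow> 4 \<Rightarrow> real"
  where "simplex_point p q r s x y z = (\<lambda>_. 0)(p := 1 - x - y - z, q := x, r := y, s := z)"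

definition unit_simplex :: "(real \<times> real \<times> real) set"
  where "unit_simplex = {(x, y, z). 0 \<le> x \<and> 0 \<le> y \<and> 0 \<le> z \<and> x + y + z \<le> 1}"

definition simplex_integral :: "4 \<Rightarrow> 4 \<Rightarrow> 4 \<Rightarrow> 4 \<Rightarrow> ((4 \<Rightarrow> real) \<Rightarrow> ennreal) \<Rightarrow> ennreal"
  where "simplex_integral p q r s G = (\<integral>\<^sup>+x. \<integral>\<^sup>+y. \<integral>\<^sup>+z.
    G (simplex_point p q r s x y z) * indicator unit_simplex (x, y, z) \<partial>lborel \<partial>lborel \<partial>lborel)"

lemma unit_simplex_borel [measurable]: "unit_simplex \<in> sets borel"
proof -
  have "unit_simplex = {w. 0 \<le> fst w \<and> 0 \<le> fst (snd w) \<and> 0 \<le> snd (snd w)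
      \<and> fst w + fst (snd w) + snd (snd w) \<le> 1}"
    by (auto simp: unit_simplex_def)
  moreover have "closed \<dots>"
    by (intro closed_Collect_conj closed_Collect_le continuous_intros)
  ultimately show ?thesis by simp
qed

text \<open>
  The cube of side \<open>1/3\<close> lies in the simplex.
\<close>

lemma unit_simplex_volume_pos: "simplex_integral p q r s (\<lambda>_. 1) > 0"
proof -
  let ?I = "indicator {0..1/3::real} :: real \<Rightarrow> ennreal"
  have "0 < ennreal (1/3) * (ennreal (1/3) * ennreal (1/3))"
    by (simp add: ennreal_zero_less_mult_iff)
  also have "\<dots> = (\<integral>\<^sup>+x. \<integral>\<^sup>+y. \<integral>\<^sup>+z. ?I x * (?I y * ?I z) \<partial>lborel \<partial>lborel \<partial>lborel)"
    by (simp add: nn_integral_cmult nn_integral_multc)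
  also have "\<dots> \<le> simplex_integral p q r s (\<lambda>_. 1)"
    unfolding simplex_integral_def
    by (intro nn_integral_mono) (auto simp: indicator_def unit_simplex_def)
  finally show ?thesis .
qed

text \<open>
  Moments as values of one positive functional: bounds and identities between integrands, which are
  functions of the barycentric coordinates only, then carry over to moments.
\<close>

definition tetrahedron_mean :: "(4 \<Rightarrow> real^3) \<Rightarrow> ((4 \<Rightarrow> real) \<Rightarrow> ennreal) \<Rightarrow> ennreal"
  where "tetrahedron_mean v G = inverse (emeasure lborel (tetrahedron v)) *
    (\<integral>\<^sup>+x\<in>tetrahedron v. G (barycentric v x) \<partial>lborel)"

lemma moment_eq_tetrahedron_mean:
  "moment v \<alpha> \<gamma> = tetrahedron_mean v (\<lambda>l. ennreal (moment_integrand \<alpha> \<gamma> l))"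
  by (simp add: moment_def tetrahedron_mean_def)

lemma tetrahedron_compact: "compact (tetrahedron v)"
  by (simp add: tetrahedron_def finite_imp_compact_convex_hull)

lemma tetrahedron_borel [measurable]: "tetrahedron v \<in> sets borel"
  by (simp add: borel_compact tetrahedron_compact)

text \<open>
  The linear part of the affine map that sends coordinates \<open>(x, y, z)\<close> to the point of space with
  barycentric coordinates \<open>simplex_point p q r s x y z\<close>.
\<close>

definition edge_map :: "(4 \<Rightarrow> real^3) \<Rightarrow> 4 \<Rightarrow> 4 \<Rightarrow> 4 \<Rightarrow> 4 \<Rightarrow> real^3 \<Rightarrow> real^3"
  where "edge_map v p q r s w = w$1 *\<^sub>R (v q - v p) + w$2 *\<^sub>R (v r - v p) + w$3 *\<^sub>R (v s - v p)"

context
  fixes v :: "4 \<Rightarrow> real^3" and p q r s :: 4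
  assumes v: "inj v" "\<not> affine_dependent (range v)"
    and D: "distinct [p, q, r, s]" and U: "UNIV = {p, q, r, s}"
begin

lemma sum_simplex_point: "(\<Sum>i\<in>UNIV. simplex_point p q r s x y z i) = 1"
  using D unfolding U by (simp add: simplex_point_def)

lemma simplex_point_combination:
  "(\<Sum>i\<in>UNIV. simplex_point p q r s (w$1) (w$2) (w$3) i *\<^sub>R v i) = v p + edge_map v p q r s w"
  using D unfolding U by (simp add: simplex_point_def edge_map_def algebra_simps)

lemma linear_edge_map: "linear (edge_map v p q r s)"
  by (intro linearI) (simp_all add: edge_map_def algebra_simps)

text \<open>
  The barycentric coordinates of the image point are unique, and they contain \<open>x, y, z\<close>.
\<close>

lemma inj_edge_map: "inj (edge_map v p q r s)"
proof (rule injI)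
  let ?l = "simplex_point p q r s"
  fix a b assume "edge_map v p q r s a = edge_map v p q r s b"
  then have "(\<Sum>i\<in>UNIV. ?l (a$1) (a$2) (a$3) i *\<^sub>R v i) = (\<Sum>i\<in>UNIV. ?l (b$1) (b$2) (b$3) i *\<^sub>R v i)"
    by (simp add: simplex_point_combination)
  then have eq: "?l (a$1) (a$2) (a$3) = ?l (b$1) (b$2) (b$3)"
    using v by (intro barycentric_coordinates_unique) (simp_all add: sum_simplex_point)
  have "a$1 = b$1" "a$2 = b$2" "a$3 = b$3"
    using fun_cong[OF eq, of q] fun_cong[OF eq, of r] fun_cong[OF eq, of s] D
    by (simp_all add: simplex_point_def)
  then show "a = b" by (simp add: vec_eq_iff forall_3)
qed

lemma barycentric_edge_map:
  "barycentric v (v p + edge_map v p q r s w) = simplex_point p q r s (w$1) (w$2) (w$3)"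
  using v sum_simplex_point simplex_point_combination by (rule barycentric_eqI)

lemma edge_map_in_tetrahedron_iff:
  "v p + edge_map v p q r s w \<in> tetrahedron v \<longleftrightarrow> (w$1, w$2, w$3) \<in> unit_simplex"
proof -
  have "v p + edge_map v p q r s w \<in> tetrahedron v \<longleftrightarrow>
      (\<forall>i\<in>UNIV. 0 \<le> simplex_point p q r s (w$1) (w$2) (w$3) i)"
    unfolding simplex_point_combination[symmetric]
    using affine_combination_in_tetrahedron_iff[OF v sum_simplex_point] by simp
  then show ?thesis
    using D unfolding U by (auto simp: simplex_point_def unit_simplex_def)
qed

text \<open>
  The coordinates of a point are affine functions of it, via the inverse of the edge map.
\<close>

lemma barycentric_measurable_labelled: "barycentric v \<in> borel_measurable borel"
proof (rule measurable_coordinatewise_then_product)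
  fix i
  define g where "g = inv (edge_map v p q r s)"
  have "linear g" and gA: "\<And>w. edge_map v p q r s (g w) = w"
    using linear_edge_map inj_edge_map linear_injective_imp_surjective[of "edge_map v p q r s"]
    by (simp_all add: g_def inj_linear_imp_inv_linear surj_f_inv_f)
  have [measurable]: "(\<lambda>x. g (x - v p) $ i) \<in> borel_measurable borel" for i
  proof -
    have "continuous_on UNIV (\<lambda>x. x - v p)"
      by (intro continuous_intros)
    from continuous_on_component[OF linear_continuous_on_compose[OF this \<open>linear g\<close>]]
    show ?thesis
      by (rule borel_measurable_continuous_onI)
  qed
  have "barycentric v x = simplex_point p q r s (g (x - v p) $ 1) (g (x - v p) $ 2) (g (x - v p) $ 3)" for x
    using barycentric_edge_map[of "g (x - v p)"] by (simp add: gA)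
  then show "(\<lambda>x. barycentric v x i) \<in> borel_measurable borel"
    unfolding simplex_point_def fun_upd_def by simp
qed

text \<open>
  The constant is positive and finite, so that finiteness can be decided in coordinates in both
  directions, and it is the same for all integrands, so that identities transfer as well.
\<close>

lemma tetrahedron_mean_eq_simplex_integral:
  "\<exists>c::ennreal. 0 < c \<and> c < \<infinity> \<and> (\<forall>G\<in>borel_measurable borel.
    tetrahedron_mean v G = c * simplex_integral p q r s G)"
proof -
  let ?T = "tetrahedron v" and ?A = "edge_map v p q r s"
  note [measurable] = barycentric_measurable_labelled
  obtain c where c: "c > 0" and subst: "\<And>h t. h \<in> borel_measurable borel \<Longrightarrow>
      (\<integral>\<^sup>+x. h x \<partial>lborel) = ennreal c * (\<integral>\<^sup>+x. h (t + ?A x) \<partial>lborel)"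
    using nn_integral_linear_substitution[OF linear_edge_map inj_edge_map] by blast
  have [measurable]: "?A \<in> borel_measurable borel"
    using linear_edge_map
    by (intro borel_measurable_continuous_onI linear_continuous_on linear_conv_bounded_linear[THEN iffD1])
  have eq: "(\<integral>\<^sup>+x\<in>?T. G (barycentric v x) \<partial>lborel) = ennreal c * simplex_integral p q r s G"
    if [measurable]: "G \<in> borel_measurable borel" for G
  proof -
    have "(\<integral>\<^sup>+x\<in>?T. G (barycentric v x) \<partial>lborel) = ennreal c *
        (\<integral>\<^sup>+w. G (barycentric v (v p + ?A w)) * indicator ?T (v p + ?A w) \<partial>lborel)"
      by (rule subst) measurable
    also have "(\<integral>\<^sup>+w. G (barycentric v (v p + ?A w)) * indicator ?T (v p + ?A w) \<partial>lborel)
        = (\<integral>\<^sup>+x. \<integral>\<^sup>+y. \<integral>\<^sup>+z. G (barycentric v (v p + ?A (vector [x, y, z]))) *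
            indicator ?T (v p + ?A (vector [x, y, z])) \<partial>lborel \<partial>lborel \<partial>lborel)"
      by (rule nn_integral_iterated_3) measurable
    also have "\<dots> = simplex_integral p q r s G"
      by (simp add: simplex_integral_def barycentric_edge_map edge_map_in_tetrahedron_iff indicator_def)
    finally show ?thesis .
  qed
  have "emeasure lborel ?T = ennreal c * simplex_integral p q r s (\<lambda>_. 1)"
    using eq[of "\<lambda>_. 1"] by simp
  then have "emeasure lborel ?T > 0"
    using c unit_simplex_volume_pos by (simp add: ennreal_zero_less_mult_iff)
  moreover have "emeasure lborel ?T < \<infinity>"
    by (intro emeasure_bounded_finite compact_imp_bounded tetrahedron_compact)
  ultimately obtain e where e: "emeasure lborel ?T = ennreal e" "e > 0"
    by (cases "emeasure lborel ?T") (auto simp: ennreal_less_zero_iff)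
  let ?c = "ennreal (inverse e * c)"
  have "0 < ?c \<and> ?c < \<infinity>" using c e(2) by simp
  moreover have "tetrahedron_mean v G = ?c * simplex_integral p q r s G"
    if "G \<in> borel_measurable borel" for G
    using c e eq[OF that]
    by (simp add: tetrahedron_mean_def inverse_ennreal ennreal_mult mult.assoc)
  ultimately show ?thesis by blast
qed

end

context
  fixes v :: "4 \<Rightarrow> real^3"
  assumes v: "inj v" "\<not> affine_dependent (range v)"
begin

lemma barycentric_measurable: "barycentric v \<in> borel_measurable borel"
proof (rule barycentric_measurable_labelled[OF v])
  show "distinct [4::4, 1, 2, 3]" by simp
  \<comment> \<open>The numeral \<open>4\<close> is another name for the vertex \<open>0\<close>.\<close>
  show "UNIV = {4::4, 1, 2, 3}" using exhaust_4 by auto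
qed

lemma barycentric_in_tetrahedron:
  assumes "x \<in> tetrahedron v"
  shows "0 \<le> barycentric v x i" "(\<Sum>i\<in>UNIV. barycentric v x i) = 1"
proof -
  obtain u where u: "\<And>i. 0 \<le> u (v i)" "(\<Sum>i\<in>UNIV. u (v i)) = 1" "(\<Sum>i\<in>UNIV. u (v i) *\<^sub>R v i) = x"
    using assms v(1) by (auto simp: tetrahedron_def convex_hull_finite sum.reindex)
  have "barycentric v x = (\<lambda>i. u (v i))"
    using v u(2,3) by (rule barycentric_eqI)
  with u show "0 \<le> barycentric v x i" "(\<Sum>i\<in>UNIV. barycentric v x i) = 1"
    by simp_all
qed

lemma tetrahedron_mean_mono:
  assumes "\<And>l. (\<And>i. 0 \<le> l i) \<Longrightarrow> (\<Sum>i\<in>UNIV. l i) = 1 \<Longrightarrow> G l \<le> H l"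
  shows "tetrahedron_mean v G \<le> tetrahedron_mean v H"
  unfolding tetrahedron_mean_def
  by (intro mult_left_mono nn_integral_mono)
     (auto simp: indicator_def intro!: assms barycentric_in_tetrahedron)

lemma tetrahedron_mean_add:
  assumes [measurable]: "G \<in> borel_measurable borel" "H \<in> borel_measurable borel"
  shows "tetrahedron_mean v (\<lambda>l. G l + H l) = tetrahedron_mean v G + tetrahedron_mean v H"
proof -
  note [measurable] = barycentric_measurable
  show ?thesis
    unfolding tetrahedron_mean_def distrib_left[symmetric] distrib_right
    by (subst nn_integral_add[symmetric]) simp_all
qed

lemma tetrahedron_mean_cmult:
  assumes [measurable]: "G \<in> borel_measurable borel"
  shows "tetrahedron_mean v (\<lambda>l. a * G l) = a * tetrahedron_mean v G"
proof -
  note [measurable] = barycentric_measurable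
  show ?thesis
    unfolding tetrahedron_mean_def
    by (simp add: mult.assoc nn_integral_cmult mult.left_commute)
qed

end

section \<open>Integration along rays\<close>

text \<open>
  Points are written as \<open>x \<cdot> (1, u, w)\<close>, so that for fixed \<open>u, w\<close> the inner integral runs along a ray
  through the origin.  For fixed \<open>x \<noteq> 0\<close> this is a scaling in each of \<open>y\<close> and \<open>z\<close>, hence
  the Jacobian \<open>x\<^sup>2\<close>; only one-dimensional substitutions and Tonelli's theorem are involved.
\<close>

lemma nn_integral_iterated_rays:
  fixes H :: "real \<times> real \<times> real \<Rightarrow> ennreal"
  assumes [measurable]: "H \<in> borel_measurable borel"
  shows "(\<integral>\<^sup>+x. \<integral>\<^sup>+y. \<integral>\<^sup>+z. H (x, y, z) \<partial>lborel \<partial>lborel \<partial>lborel)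
    = (\<integral>\<^sup>+u. \<integral>\<^sup>+w. \<integral>\<^sup>+x. ennreal (x\<^sup>2) * H (x, x * u, x * w) \<partial>lborel \<partial>lborel \<partial>lborel)"
proof -
  have [measurable]: "H \<in> borel_measurable (borel \<Otimes>\<^sub>M (borel \<Otimes>\<^sub>M borel))"
    by (simp add: borel_prod)
  have "(\<integral>\<^sup>+y. \<integral>\<^sup>+z. H (x, y, z) \<partial>lborel \<partial>lborel)
     = (\<integral>\<^sup>+u. \<integral>\<^sup>+w. ennreal (x\<^sup>2) * H (x, x * u, x * w) \<partial>lborel \<partial>lborel)" if "x \<noteq> 0" for x
  proof -
    have "(\<integral>\<^sup>+y. \<integral>\<^sup>+z. H (x, y, z) \<partial>lborel \<partial>lborel)
       = ennreal \<bar>x\<bar> * (\<integral>\<^sup>+u. \<integral>\<^sup>+z. H (x, x * u, z) \<partial>lborel \<partial>lborel)"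
      using that by (subst nn_integral_real_affine[where t = 0 and c = x]) simp_all
    also have "\<dots> = ennreal \<bar>x\<bar> * (\<integral>\<^sup>+u. ennreal \<bar>x\<bar> * (\<integral>\<^sup>+w. H (x, x * u, x * w) \<partial>lborel) \<partial>lborel)"
      using that
      by (subst nn_integral_real_affine[where t = 0 and c = x and f = "\<lambda>z. H (x, _, z)"]) simp_all
    also have "\<dots> = (\<integral>\<^sup>+u. \<integral>\<^sup>+w. ennreal \<bar>x\<bar> * (ennreal \<bar>x\<bar> * H (x, x * u, x * w)) \<partial>lborel \<partial>lborel)"
      by (simp add: nn_integral_cmult)
    also have "\<dots> = (\<integral>\<^sup>+u. \<integral>\<^sup>+w. ennreal (x\<^sup>2) * H (x, x * u, x * w) \<partial>lborel \<partial>lborel)"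
      by (simp add: mult.assoc[symmetric] ennreal_mult[symmetric] power2_eq_square)
    finally show ?thesis .
  qed
  then have "(\<integral>\<^sup>+x. \<integral>\<^sup>+y. \<integral>\<^sup>+z. H (x, y, z) \<partial>lborel \<partial>lborel \<partial>lborel)
     = (\<integral>\<^sup>+x. \<integral>\<^sup>+u. \<integral>\<^sup>+w. ennreal (x\<^sup>2) * H (x, x * u, x * w) \<partial>lborel \<partial>lborel \<partial>lborel)"
    using AE_lborel_singleton[of 0] by (intro nn_integral_cong_AE) auto
  also have "\<dots> = (\<integral>\<^sup>+u. \<integral>\<^sup>+x. \<integral>\<^sup>+w. ennreal (x\<^sup>2) * H (x, x * u, x * w) \<partial>lborel \<partial>lborel \<partial>lborel)"
    by (rule lborel_pair.Fubini'[symmetric]) measurable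
  also have "\<dots> = (\<integral>\<^sup>+u. \<integral>\<^sup>+w. \<integral>\<^sup>+x. ennreal (x\<^sup>2) * H (x, x * u, x * w) \<partial>lborel \<partial>lborel \<partial>lborel)"
    by (intro nn_integral_cong lborel_pair.Fubini'[symmetric]) measurable
  finally show ?thesis .
qed

text \<open>
  The analytic core.  Along a ray, the moment integrand together with the Jacobian is a constant
  multiple of \<open>x\<^sup>m (1 - (b+1) x)\<^sup>a\<^sup>+\<^sup>1 / (1 - b x)\<^sup>g\<close>; here \<open>1 - (b+1) x\<close> is \<open>\<lambda>\<^sub>k\<close> and \<open>1 - b x\<close> is
  \<open>\<lambda>\<^sub>0 + \<lambda>\<^sub>k\<close>.  The function \<open>?F\<close> of the proof, which is \<open>x\<close> times this, vanishes at both ends of the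
  interval: at \<open>0\<close> because of the factor \<open>x\<^sup>m\<^sup>+\<^sup>1\<close>, and at \<open>1/(b+1)\<close>, which is the face \<open>\<lambda>\<^sub>k = 0\<close>,
  because the exponent of \<open>\<lambda>\<^sub>k\<close> is positive.  Hence the integral of its derivative is zero, and the
  derivative is the difference of the two integrands below.  Both are nonnegative, so that their
  equality can be stated in \<open>[0, \<infinity>]\<close>.
\<close>

lemma nn_integral_ray_by_parts:
  fixes m a g :: nat and b D :: real
  assumes b: "b \<ge> 0" and D: "D = real m + 1 + real (Suc a) - real g" "D \<ge> 0"
  shows "(\<integral>\<^sup>+x\<in>{0..1/(b+1)}. ennreal (D * (x^m * (1 - (b+1)*x)^Suc a * inverse (1 - b*x)^g) +
            real g * (x^m * (1 - (b+1)*x)^Suc a * inverse (1 - b*x)^Suc g)) \<partial>lborel)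
       = (\<integral>\<^sup>+x\<in>{0..1/(b+1)}. ennreal (real (Suc a) * (x^m * (1 - (b+1)*x)^a * inverse (1 - b*x)^g)) \<partial>lborel)"
    (is "(\<integral>\<^sup>+x\<in>?I. ennreal (?P x) \<partial>_) = (\<integral>\<^sup>+x\<in>?I. ennreal (?Q x) \<partial>_)")
proof -
  let ?F = "\<lambda>x. x^Suc m * (1 - (b+1)*x)^Suc a * inverse (1 - b*x)^g"
  have pos: "1 - b * x > 0" "1 - (b+1)*x \<ge> 0" "x \<ge> 0" if "x \<in> ?I" for x
  proof -
    from that b have *: "x \<ge> 0" "(b+1) * x \<le> 1" by (auto simp: field_simps)
    then show "1 - (b+1)*x \<ge> 0" "x \<ge> 0" by auto
    show "1 - b * x > 0" using * by (cases "x = 0") (auto simp: algebra_simps)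
  qed
  have "(?F has_real_derivative ?P x - ?Q x) (at x within ?I)" if x: "x \<in> ?I" for x
  proof -
    have B: "1 - b * x \<noteq> 0" using pos[OF x] by simp
    have 1: "((\<lambda>x. inverse (1 - b*x)^g) has_real_derivative real g * b * inverse (1 - b*x)^Suc g) (at x within ?I)"
    proof -
      have "((\<lambda>x. inverse (1 - b*x)) has_real_derivative b * inverse (1 - b*x)^2) (at x within ?I)"
        using B by (auto intro!: derivative_eq_intros simp: power2_eq_square)
      from DERIV_power[OF this, of g] show ?thesis
        by (cases g) (simp_all add: power2_eq_square algebra_simps)
    qed
    have "(?F has_real_derivative
        real (Suc m) * x^m * (1 - (b+1)*x)^Suc a * inverse (1 - b*x)^g
        - x^Suc m * (real (Suc a) * (b+1) * (1 - (b+1)*x)^a) * inverse (1 - b*x)^g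
        + x^Suc m * (1 - (b+1)*x)^Suc a * (real g * b * inverse (1 - b*x)^Suc g)) (at x within ?I)"
      by (rule derivative_eq_intros 1 refl | simp)+ (simp add: algebra_simps)
    also have "real (Suc m) * x^m * (1 - (b+1)*x)^Suc a * inverse (1 - b*x)^g
        - x^Suc m * (real (Suc a) * (b+1) * (1 - (b+1)*x)^a) * inverse (1 - b*x)^g
        + x^Suc m * (1 - (b+1)*x)^Suc a * (real g * b * inverse (1 - b*x)^Suc g) = ?P x - ?Q x"
    proof -
      \<comment> \<open>\<open>A = \<lambda>\<^sub>k\<close> and \<open>B = \<lambda>\<^sub>0 + \<lambda>\<^sub>k\<close>; eliminating \<open>x (b+1)\<close> and \<open>x b\<close> in their favour gives the three terms.\<close>
      define A B R where "A = 1 - (b+1)*x" and "B = 1 - b*x" and "R = inverse B"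
      have BR: "B * R = 1" using B by (simp add: B_def R_def)
      have x: "1 - A = x * (b+1)" "1 - B = x * b" by (simp_all add: A_def B_def)
      have "real (Suc m) * x^m * A^Suc a * R^g - x^Suc m * (real (Suc a) * (b+1) * A^a) * R^g
          + x^Suc m * A^Suc a * (real g * b * R^Suc g)
        = x^m * A^a * R^g * (real (Suc m) * A - real (Suc a) * (1 - A) + A * real g * (1 - B) * R)"
        unfolding x by (simp add: algebra_simps)
      also have "A * real g * (1 - B) * R = A * real g * R - A * real g"
        using BR by algebra
      also have "x^m * A^a * R^g * (real (Suc m) * A - real (Suc a) * (1 - A) + (A * real g * R - A * real g))
        = D * (x^m * A^Suc a * R^g) + real g * (x^m * A^Suc a * R^Suc g) - real (Suc a) * (x^m * A^a * R^g)"
        unfolding D(1) by (simp add: algebra_simps)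
      finally show ?thesis unfolding A_def B_def R_def .
    qed
    finally show ?thesis .
  qed
  then have "((\<lambda>x. ?P x - ?Q x) has_integral (?F (1/(b+1)) - ?F 0)) ?I"
    using b by (intro fundamental_theorem_of_calculus)
      (auto simp: has_real_derivative_iff_has_vector_derivative[symmetric])
  then have PQ: "((\<lambda>x. ?P x - ?Q x) has_integral 0) ?I"
    using b by simp
  have "?P integrable_on ?I"
    using pos(1) by (intro integrable_continuous_real continuous_intros) (auto simp: less_le)
  then obtain r where P: "(?P has_integral r) ?I" by blast
  then have Q: "(?Q has_integral r) ?I"
    using has_integral_diff[OF P PQ] by simp
  have "(\<integral>\<^sup>+x\<in>?I. ennreal (?P x) \<partial>lborel) = ennreal r"
  proof (rule nn_integral_has_integral_lebesgue'[OF _ P])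
    fix x assume "x \<in> ?I"
    from pos[OF this] D(2) show "0 \<le> ?P x"
      by (intro add_nonneg_nonneg mult_nonneg_nonneg zero_le_power) auto
  qed
  moreover have "(\<integral>\<^sup>+x\<in>?I. ennreal (?Q x) \<partial>lborel) = ennreal r"
  proof (rule nn_integral_has_integral_lebesgue'[OF _ Q])
    fix x assume "x \<in> ?I"
    from pos[OF this] show "0 \<le> ?Q x"
      by (intro mult_nonneg_nonneg zero_le_power) auto
  qed
  ultimately show ?thesis by simp
qed

section \<open>The moment integrand in simplex coordinates\<close>

text \<open>
  The index \<open>3\<close> of a multi-index is the zero of its type, whereas the vertex \<open>3\<close> is not the vertex \<open>0\<close>;
  hence the case distinction instead of a coercion.
\<close>

definition vertex :: "3 \<Rightarrow> 4"
  where "vertex j = (if j = 1 then 1 else if j = 2 then 2 else 3)"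

lemma moment_integrand_eq_prod:
  "moment_integrand \<alpha> \<gamma> l =
    (\<Prod>j\<in>UNIV. l (vertex j) ^ (\<alpha> $ j) / (l 0 + l (vertex j)) ^ (\<gamma> $ j))"
  unfolding UNIV_3 moment_integrand_def vertex_def by simp

lemma vertex_cases:
  assumes "distinct [k, i, j]"
  shows "UNIV = {k, i, j}" "UNIV = {vertex k, 0, vertex i, vertex j}"
    "distinct [vertex k, 0, vertex i, vertex j]"
proof -
  show "UNIV = {k, i, j}"
    using assms by (intro card_subset_eq[symmetric]) simp_all
  have "inj vertex"
    by (simp add: inj_def forall_3 vertex_def)
  moreover have *: "vertex j \<noteq> 0" for j
    by (simp add: vertex_def)
  ultimately show "distinct [vertex k, 0, vertex i, vertex j]"
    using assms *[of i] *[of k] *[of j] by (simp add: inj_eq *[symmetric])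
  then show "UNIV = {vertex k, 0, vertex i, vertex j}"
    by (intro card_subset_eq[symmetric]) simp_all
qed

lemma other_indices:
  fixes i :: 3
  obtains k j :: 3 where "distinct [i, k, j]"
proof -
  have "distinct [1, 2, 3::3]" "distinct [2, 1, 3::3]" "distinct [3, 1, 2::3]" by simp_all
  with that exhaust_3[of i] show ?thesis by metis
qed

text \<open>
  The labelling used throughout: \<open>x, y, z\<close> are the coordinates of the vertices \<open>0, i, j\<close>, and the
  distinguished vertex \<open>k\<close> is the origin.
\<close>

lemma moment_integrand_simplex_point:
  assumes "distinct [k, i, j]"
  shows "moment_integrand \<alpha> \<gamma> (simplex_point (vertex k) 0 (vertex i) (vertex j) x y z) =
    ((1 - x - y - z) ^ (\<alpha> $ k) / (1 - y - z) ^ (\<gamma> $ k)) *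
    (y ^ (\<alpha> $ i) / (x + y) ^ (\<gamma> $ i)) * (z ^ (\<alpha> $ j) / (x + z) ^ (\<gamma> $ j))"
proof -
  let ?l = "simplex_point (vertex k) 0 (vertex i) (vertex j) x y z"
  have l: "?l (vertex k) = 1 - x - y - z" "?l 0 = x" "?l (vertex i) = y" "?l (vertex j) = z"
    using vertex_cases(3)[OF assms] by (simp_all add: simplex_point_def)
  have e: "x + (1 - x - y - z) = 1 - y - z" by simp
  have prod: "prod f {k, i, j} = f k * f i * f j" for f :: "3 \<Rightarrow> real"
    using assms by (simp add: mult.assoc)
  show ?thesis
    unfolding moment_integrand_eq_prod vertex_cases(1)[OF assms] prod by (simp only: l e)
qed

lemma moment_integrand_measurable [measurable]: "moment_integrand \<alpha> \<gamma> \<in> borel_measurable borel"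
  unfolding moment_integrand_eq_prod[abs_def] by measurable

lemma simplex_point_measurable [measurable]:
  "(\<lambda>(x, y, z). simplex_point p q r s x y z) \<in> borel \<rightarrow>\<^sub>M borel"
proof -
  have "(\<lambda>(x, y, z). simplex_point p q r s x y z) \<in> borel \<Otimes>\<^sub>M (borel \<Otimes>\<^sub>M borel) \<rightarrow>\<^sub>M borel"
    by (intro measurable_coordinatewise_then_product)
      (simp add: simplex_point_def fun_upd_def case_prod_beta)
  then show ?thesis by (simp add: borel_prod)
qed

section \<open>Integration by parts over the tetrahedron\<close>

text \<open>
  The factors belonging to \<open>i\<close> and \<open>j\<close> are homogeneous in \<open>(\<lambda>\<^sub>0, \<lambda>\<^sub>i)\<close> and \<open>(\<lambda>\<^sub>0, \<lambda>\<^sub>j)\<close>, so on a ray each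
  is a power of \<open>x\<close> times a function of the direction.  Each absorbs one of the two powers of \<open>x\<close> in
  the Jacobian, which makes the exponents \<open>\<alpha>\<^sub>i + 1 - \<gamma>\<^sub>i\<close> and \<open>\<alpha>\<^sub>j + 1 - \<gamma>\<^sub>j\<close> nonnegative.
\<close>

lemma moment_integrand_ray:
  fixes x u w :: real
  assumes x: "x > 0" and ij: "gi \<le> Suc ai" "gj \<le> Suc aj"
  shows "x\<^sup>2 * (((1 - x - x*u - x*w) ^ a / (1 - x*u - x*w) ^ g) *
      ((x*u) ^ ai / (x + x*u) ^ gi) * ((x*w) ^ aj / (x + x*w) ^ gj)) =
    (u ^ ai / (1 + u) ^ gi * (w ^ aj / (1 + w) ^ gj)) *
    (x ^ (Suc ai - gi + (Suc aj - gj)) * (1 - (u + w + 1) * x) ^ a * inverse (1 - (u + w) * x) ^ g)"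
proof -
  have pow: "x * ((x*t) ^ e / (x + x*t) ^ f) = x ^ (Suc e - f) * (t ^ e / (1 + t) ^ f)"
    if "f \<le> Suc e" for t e f
  proof -
    have "x + x * t = x * (1 + t)" by (simp add: algebra_simps)
    then have "x * ((x*t) ^ e / (x + x*t) ^ f) = (x ^ Suc e / x ^ f) * (t ^ e / (1 + t) ^ f)"
      by (simp add: power_mult_distrib)
    also have "x ^ Suc e / x ^ f = x ^ (Suc e - f)"
      using x that by (simp only: power_diff)
    finally show ?thesis .
  qed
  have 1: "1 - x - x*u - x*w = 1 - (u + w + 1) * x" and 2: "1 - x*u - x*w = 1 - (u + w) * x"
    by (simp_all add: algebra_simps)
  have "x\<^sup>2 * (((1 - x - x*u - x*w) ^ a / (1 - x*u - x*w) ^ g) *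
      ((x*u) ^ ai / (x + x*u) ^ gi) * ((x*w) ^ aj / (x + x*w) ^ gj)) =
    ((1 - x - x*u - x*w) ^ a / (1 - x*u - x*w) ^ g) *
    (x * ((x*u) ^ ai / (x + x*u) ^ gi)) * (x * ((x*w) ^ aj / (x + x*w) ^ gj))"
    by (simp only: power2_eq_square mult_ac)
  also have "\<dots> = (u ^ ai / (1 + u) ^ gi * (w ^ aj / (1 + w) ^ gj)) *
    (x ^ (Suc ai - gi + (Suc aj - gj)) * (1 - (u + w + 1) * x) ^ a * inverse (1 - (u + w) * x) ^ g)"
    unfolding pow[OF ij(1)] pow[OF ij(2)] 1 2
    by (simp only: divide_inverse power_inverse power_add mult_ac)
  finally show ?thesis .
qed

lemma simplex_integral_eq_ray_integral:
  assumes [measurable]: "G \<in> borel_measurable borel"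
  shows "simplex_integral p q r s G =
    (\<integral>\<^sup>+u. \<integral>\<^sup>+w. \<integral>\<^sup>+x. ennreal (x\<^sup>2) * (G (simplex_point p q r s x (x*u) (x*w)) *
      indicator unit_simplex (x, x*u, x*w)) \<partial>lborel \<partial>lborel \<partial>lborel)"
proof -
  let ?H = "\<lambda>t. G ((\<lambda>(x,y,z). simplex_point p q r s x y z) t) * indicator unit_simplex t"
  have "?H \<in> borel_measurable borel" by measurable
  from nn_integral_iterated_rays[OF this] show ?thesis
    by (simp add: simplex_integral_def)
qed

lemma indicator_unit_simplex_ray:
  assumes "x \<noteq> 0" "u \<ge> 0" "w \<ge> 0"
  shows "(x, x*u, x*w) \<in> unit_simplex \<longleftrightarrow> x \<in> {0..1/(u + w + 1)}"
proof -
  have "x + x*u + x*w = x * (u + w + 1)" by (simp add: algebra_simps)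
  moreover have "x * (u + w + 1) \<le> 1 \<longleftrightarrow> x \<le> 1 / (u + w + 1)"
    using assms by (subst pos_le_divide_eq) simp_all
  ultimately show ?thesis
    using assms by (auto simp: unit_simplex_def)
qed

text \<open>
  The two sides agree on each ray separately.  The identity is written without subtraction, so that
  it makes sense before finiteness is known.
\<close>

lemma simplex_integral_by_parts:
  fixes \<alpha> \<gamma> :: "nat^3"
  assumes kij: "distinct [k, i, j]"
    and le: "\<gamma>$i \<le> Suc (\<alpha>$i)" "\<gamma>$j \<le> Suc (\<alpha>$j)" and k: "\<alpha>$k > 0"
    and D: "D = real (Suc (\<alpha>$i) - \<gamma>$i + (Suc (\<alpha>$j) - \<gamma>$j)) + 1 + real (\<alpha>$k) - real (\<gamma>$k)" "D \<ge> 0"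
  shows "simplex_integral (vertex k) 0 (vertex i) (vertex j)
      (\<lambda>l. ennreal D * ennreal (moment_integrand \<alpha> \<gamma> l) +
        ennreal (real (\<gamma>$k)) * ennreal (moment_integrand \<alpha> (\<gamma> + axis k 1) l))
    = simplex_integral (vertex k) 0 (vertex i) (vertex j)
      (\<lambda>l. ennreal (real (\<alpha>$k)) * ennreal (moment_integrand (\<alpha> - axis k 1) \<gamma> l))"
    (is "simplex_integral ?p 0 ?r ?s ?G = simplex_integral ?p 0 ?r ?s ?H")
proof -
  obtain a where a: "\<alpha>$k = Suc a" using k by (cases "\<alpha>$k") auto
  define m where "m = Suc (\<alpha>$i) - \<gamma>$i + (Suc (\<alpha>$j) - \<gamma>$j)"
  let ?ind = "\<lambda>u w x. indicator unit_simplex (x, x*u, x*w) :: ennreal"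
  let ?l = "\<lambda>u w x. simplex_point ?p 0 ?r ?s x (x*u) (x*w)"
  have comp: "(\<alpha> - axis k 1)$k = a" "(\<alpha> - axis k 1)$i = \<alpha>$i" "(\<alpha> - axis k 1)$j = \<alpha>$j"
    "(\<gamma> + axis k 1)$k = Suc (\<gamma>$k)" "(\<gamma> + axis k 1)$i = \<gamma>$i" "(\<gamma> + axis k 1)$j = \<gamma>$j"
    using kij a by (auto simp: axis_def)
  have "(\<integral>\<^sup>+x. ennreal (x\<^sup>2) * (?G (?l u w x) * ?ind u w x) \<partial>lborel) =
      (\<integral>\<^sup>+x. ennreal (x\<^sup>2) * (?H (?l u w x) * ?ind u w x) \<partial>lborel)" for u w
  proof (cases "u \<ge> 0 \<and> w \<ge> 0")
    case False
    \<comment> \<open>The ray misses the simplex except possibly at the origin, where \<open>x\<^sup>2 = 0\<close>.\<close>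
    have "ennreal (x\<^sup>2) * (F * ?ind u w x) = 0" for x F
      using False by (cases "x = 0") (auto simp: indicator_def unit_simplex_def zero_le_mult_iff)
    then show ?thesis by (simp only:)
  next
    case True
    then have uw: "u \<ge> 0" "w \<ge> 0" by auto
    define b where "b = u + w"
    define K where "K = u ^ (\<alpha>$i) / (1 + u) ^ (\<gamma>$i) * (w ^ (\<alpha>$j) / (1 + w) ^ (\<gamma>$j))"
    have K: "K \<ge> 0" using uw by (simp add: K_def)
    define f where "f a' g' x = x^m * (1 - (b+1)*x)^a' * inverse (1 - b*x)^g'" for a' g' and x :: real
    have f_nonneg: "0 \<le> f a' g' x" if "x \<in> {0..1/(b+1)}" for a' g' x
    proof -
      have "0 \<le> b" using uw by (simp add: b_def)
      with that have "x \<ge> 0" "(b+1) * x \<le> 1" by (auto simp: field_simps)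
      then have "x \<ge> 0" "1 - (b+1)*x \<ge> 0" "1 - b * x \<ge> 0" by (auto simp: algebra_simps)
      then show ?thesis unfolding f_def by (intro mult_nonneg_nonneg zero_le_power) auto
    qed
    have mi: "x\<^sup>2 * moment_integrand \<alpha>' \<gamma>' (?l u w x) = K * f (\<alpha>'$k) (\<gamma>'$k) x"
      if "x > 0" "\<alpha>'$i = \<alpha>$i" "\<alpha>'$j = \<alpha>$j" "\<gamma>'$i = \<gamma>$i" "\<gamma>'$j = \<gamma>$j" for x \<alpha>' \<gamma>'
      unfolding moment_integrand_simplex_point[OF kij] that f_def K_def m_def b_def
      by (rule moment_integrand_ray) (use that le in auto)
    have mi_nonneg: "0 \<le> moment_integrand \<alpha>' \<gamma>' (?l u w x)"
      if "x > 0" "x \<in> {0..1/(b+1)}" "\<alpha>'$i = \<alpha>$i" "\<alpha>'$j = \<alpha>$j" "\<gamma>'$i = \<gamma>$i" "\<gamma>'$j = \<gamma>$j"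
      for x \<alpha>' \<gamma>'
    proof -
      have "0 \<le> x\<^sup>2 * moment_integrand \<alpha>' \<gamma>' (?l u w x)"
        using mi[OF that(1,3-6)] K f_nonneg[OF that(2)] by simp
      then show ?thesis using that(1) by (simp add: zero_le_mult_iff)
    qed
    have mem: "?ind u w x = indicator {0..1/(b+1)} x" if "x \<noteq> 0" for x
      using indicator_unit_simplex_ray[OF that uw] by (simp add: indicator_def b_def)
    \<comment> \<open>The origin is excluded since \<open>x\<^sup>2 = 0\<close> but \<open>x\<^sup>m = 1\<close> there if \<open>m = 0\<close>.\<close>
    have G: "ennreal (x\<^sup>2) * (?G (?l u w x) * ?ind u w x) = ennreal K *
      (ennreal (D * f (Suc a) (\<gamma>$k) x + real (\<gamma>$k) * f (Suc a) (Suc (\<gamma>$k)) x) * indicator {0..1/(b+1)} x)"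
      if "x \<noteq> 0" for x
    proof (cases "x \<in> {0..1/(b+1)}")
      case x: True
      with that have "x > 0" by auto
      let ?M = "moment_integrand \<alpha> \<gamma> (?l u w x)" and ?N = "moment_integrand \<alpha> (\<gamma> + axis k 1) (?l u w x)"
      have nn: "0 \<le> ?M" "0 \<le> ?N"
        using mi_nonneg[OF \<open>x > 0\<close> x] comp by simp_all
      have "x\<^sup>2 * (D * ?M + real (\<gamma>$k) * ?N) = D * (x\<^sup>2 * ?M) + real (\<gamma>$k) * (x\<^sup>2 * ?N)"
        by (simp add: algebra_simps)
      also have "\<dots> = K * (D * f (Suc a) (\<gamma>$k) x + real (\<gamma>$k) * f (Suc a) (Suc (\<gamma>$k)) x)"
        using mi[OF \<open>x > 0\<close>, of \<alpha> \<gamma>] mi[OF \<open>x > 0\<close>, of \<alpha> "\<gamma> + axis k 1"] comp a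
        by (simp add: algebra_simps)
      finally have "ennreal (x\<^sup>2) * ennreal (D * ?M + real (\<gamma>$k) * ?N) =
          ennreal K * ennreal (D * f (Suc a) (\<gamma>$k) x + real (\<gamma>$k) * f (Suc a) (Suc (\<gamma>$k)) x)"
        using K by (simp add: ennreal_mult'[symmetric])
      moreover have "?G (?l u w x) = ennreal (D * ?M + real (\<gamma>$k) * ?N)"
        using nn D(2) by (simp add: ennreal_mult)
      ultimately show ?thesis
        using x mem[OF that] by simp
    qed (use mem[OF that] in simp)
    have H: "ennreal (x\<^sup>2) * (?H (?l u w x) * ?ind u w x) = ennreal K *
      (ennreal (real (Suc a) * f a (\<gamma>$k) x) * indicator {0..1/(b+1)} x)" if "x \<noteq> 0" for x
    proof (cases "x \<in> {0..1/(b+1)}")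
      case x: True
      with that have "x > 0" by auto
      let ?M = "moment_integrand (\<alpha> - axis k 1) \<gamma> (?l u w x)"
      have "x\<^sup>2 * (real (Suc a) * ?M) = K * (real (Suc a) * f a (\<gamma>$k) x)"
        using mi[OF \<open>x > 0\<close>, of "\<alpha> - axis k 1" \<gamma>] comp by (simp add: algebra_simps)
      then have "ennreal (x\<^sup>2) * ennreal (real (Suc a) * ?M) = ennreal K * ennreal (real (Suc a) * f a (\<gamma>$k) x)"
        by (simp only: ennreal_mult'[OF K, symmetric] ennreal_mult'[OF zero_le_power2, symmetric])
      moreover have "?H (?l u w x) = ennreal (real (Suc a) * ?M)"
        unfolding a by (subst ennreal_mult') simp_all
      ultimately show ?thesis
        using x mem[OF that] by simp
    qed (use mem[OF that] in simp)
    have "(\<integral>\<^sup>+x. ennreal (x\<^sup>2) * (?G (?l u w x) * ?ind u w x) \<partial>lborel) = (\<integral>\<^sup>+x. ennreal K *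
      (ennreal (D * f (Suc a) (\<gamma>$k) x + real (\<gamma>$k) * f (Suc a) (Suc (\<gamma>$k)) x) * indicator {0..1/(b+1)} x) \<partial>lborel)"
      by (rule nn_integral_cong_AE, rule AE_mp[OF AE_lborel_singleton[of 0]], intro AE_I2 impI G)
    also have "\<dots> = ennreal K * (\<integral>\<^sup>+x\<in>{0..1/(b+1)}.
      ennreal (D * f (Suc a) (\<gamma>$k) x + real (\<gamma>$k) * f (Suc a) (Suc (\<gamma>$k)) x) \<partial>lborel)"
      unfolding f_def by (rule nn_integral_cmult) measurable
    also have "\<dots> = ennreal K * (\<integral>\<^sup>+x\<in>{0..1/(b+1)}. ennreal (real (Suc a) * f a (\<gamma>$k) x) \<partial>lborel)"
      unfolding f_def
      by (subst nn_integral_ray_by_parts) (use uw D in \<open>simp_all add: b_def m_def a\<close>)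
    also have "\<dots> = (\<integral>\<^sup>+x. ennreal K * (ennreal (real (Suc a) * f a (\<gamma>$k) x) * indicator {0..1/(b+1)} x) \<partial>lborel)"
      unfolding f_def by (rule nn_integral_cmult[symmetric]) measurable
    also have "\<dots> = (\<integral>\<^sup>+x. ennreal (x\<^sup>2) * (?H (?l u w x) * ?ind u w x) \<partial>lborel)"
      by (rule nn_integral_cong_AE, rule AE_mp[OF AE_lborel_singleton[of 0]], intro AE_I2 impI H[symmetric])
    finally show ?thesis .
  qed
  then show ?thesis
    by (subst (1 2) simplex_integral_eq_ray_integral) simp_all
qed

section \<open>Finite moments\<close>

text \<open>
  The exponents are a compromise: in \<open>1 / ((x + y) (x + z))\<close> the variable \<open>x\<close> occurs twice, so the
  exponent \<open>1/4\<close> for \<open>x\<close> and \<open>3/4\<close> for the other variable leave the integrable singularities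
  \<open>x powr (-1/2)\<close>, \<open>y powr (-3/4)\<close> and \<open>z powr (-3/4)\<close>.  The symmetric bound with square roots would
  give \<open>1/x\<close>.
\<close>

lemma mixed_powr_le_add:
  fixes x y :: real
  assumes "x > 0" "y > 0"
  shows "x powr (1/4) * y powr (3/4) \<le> x + y"
proof -
  have "x powr (1/4) * y powr (3/4) \<le> (x + y) powr (1/4) * (x + y) powr (3/4)"
    using assms by (intro mult_mono powr_mono2) auto
  also have "\<dots> = x + y"
    using assms by (simp add: powr_add[symmetric])
  finally show ?thesis .
qed

lemma inverse_add_add_le:
  fixes x y z :: real
  assumes "x > 0" "y > 0" "z > 0"
  shows "inverse ((x + y) * (x + z)) \<le> x powr (-1/2) * (y powr (-3/4) * z powr (-3/4))"
proof -
  have "inverse ((x + y) * (x + z))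
      \<le> inverse ((x powr (1/4) * y powr (3/4)) * (x powr (1/4) * z powr (3/4)))"
    using assms by (intro le_imp_inverse_le mult_mono mixed_powr_le_add mult_pos_pos) auto
  also have "\<dots> = inverse ((x powr (1/4) * x powr (1/4)) * (y powr (3/4) * z powr (3/4)))"
    by (simp only: mult_ac)
  also have "\<dots> = x powr (-1/2) * (y powr (-3/4) * z powr (-3/4))"
    using assms by (simp add: powr_add[symmetric] powr_minus[symmetric] del: inverse_mult_distrib)
      (simp add: powr_minus)
  finally show ?thesis .
qed

lemma nn_integral_powr_unit_interval_finite:
  fixes a :: real
  assumes "a > -1"
  shows "(\<integral>\<^sup>+x\<in>{0..1}. ennreal (x powr a) \<partial>lborel) < \<infinity>"
  using nn_integral_has_integral_lebesgue'[OF _ has_integral_powr_from_0[OF assms, of 1]] by simp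

text \<open>
  Up to a constant, this bounds the integrand of a finite moment near the vertex other than \<open>0, r, s\<close>,
  where both sums in the denominator are small.
\<close>

definition edge_weight :: "4 \<Rightarrow> 4 \<Rightarrow> (4 \<Rightarrow> real) \<Rightarrow> ennreal"
  where "edge_weight r s l = ennreal (inverse ((l 0 + l r) * (l 0 + l s)))"

lemma edge_weight_measurable [measurable]: "edge_weight r s \<in> borel_measurable borel"
  unfolding edge_weight_def[abs_def] by measurable

text \<open>
  Off the coordinate planes, a null set, the weight is at most a product of integrable functions of
  one variable each.
\<close>

lemma simplex_integral_edge_weight_finite:
  assumes "distinct [p, 0, r, s]"
  shows "simplex_integral p 0 r s (edge_weight r s) < \<infinity>"
proof -
  let ?f = "\<lambda>x. ennreal (x powr (-1/2)) * indicator {0..1} x"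
  let ?g = "\<lambda>x. ennreal (x powr (-3/4)) * indicator {0..1} x"
  have le: "edge_weight r s (simplex_point p 0 r s x y z) * indicator unit_simplex (x, y, z)
      \<le> ?f x * (?g y * ?g z)" if "x \<noteq> 0" "y \<noteq> 0" "z \<noteq> 0" for x y z
  proof (cases "(x, y, z) \<in> unit_simplex")
    case True
    with that have "0 < x" "0 < y" "0 < z" "x \<le> 1" "y \<le> 1" "z \<le> 1"
      by (auto simp: unit_simplex_def)
    then show ?thesis
      using assms True inverse_add_add_le[of x y z]
      by (simp add: edge_weight_def simplex_point_def ennreal_mult'[symmetric])
  qed simp
  have "simplex_integral p 0 r s (edge_weight r s)
    \<le> (\<integral>\<^sup>+x. \<integral>\<^sup>+y. \<integral>\<^sup>+z. ?f x * (?g y * ?g z) \<partial>lborel \<partial>lborel \<partial>lborel)"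
    unfolding simplex_integral_def
  proof (rule nn_integral_mono_AE, rule AE_mp[OF AE_lborel_singleton[of 0]], intro AE_I2 impI)
    fix x :: real assume x: "x \<noteq> 0"
    show "(\<integral>\<^sup>+y. \<integral>\<^sup>+z. edge_weight r s (simplex_point p 0 r s x y z) *
        indicator unit_simplex (x, y, z) \<partial>lborel \<partial>lborel)
      \<le> (\<integral>\<^sup>+y. \<integral>\<^sup>+z. ?f x * (?g y * ?g z) \<partial>lborel \<partial>lborel)"
    proof (rule nn_integral_mono_AE, rule AE_mp[OF AE_lborel_singleton[of 0]], intro AE_I2 impI)
      fix y :: real assume y: "y \<noteq> 0"
      show "(\<integral>\<^sup>+z. edge_weight r s (simplex_point p 0 r s x y z) *
          indicator unit_simplex (x, y, z) \<partial>lborel) \<le> (\<integral>\<^sup>+z. ?f x * (?g y * ?g z) \<partial>lborel)"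
        by (rule nn_integral_mono_AE, rule AE_mp[OF AE_lborel_singleton[of 0]], intro AE_I2 impI le x y)
    qed
  qed
  also have "\<dots> = (\<integral>\<^sup>+x. ?f x \<partial>lborel) * ((\<integral>\<^sup>+x. ?g x \<partial>lborel) * (\<integral>\<^sup>+x. ?g x \<partial>lborel))"
    by (simp add: nn_integral_cmult nn_integral_multc)
  also have "\<dots> < \<infinity>"
    using nn_integral_powr_unit_interval_finite[of "-1/2"] nn_integral_powr_unit_interval_finite[of "-3/4"]
    by (simp add: ennreal_mult_less_top)
  finally show ?thesis .
qed

lemma tetrahedron_mean_edge_weight_finite:
  assumes v: "inj v" "\<not> affine_dependent (range v)" and kij: "distinct [k, i, j]"
  shows "tetrahedron_mean v (edge_weight (vertex i) (vertex j)) < \<infinity>"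
proof -
  obtain c where c: "c < \<infinity>" "tetrahedron_mean v (edge_weight (vertex i) (vertex j)) =
      c * simplex_integral (vertex k) 0 (vertex i) (vertex j) (edge_weight (vertex i) (vertex j))"
    using tetrahedron_mean_eq_simplex_integral[OF v vertex_cases(3,2)[OF kij]] edge_weight_measurable
    by blast
  then show ?thesis
    using simplex_integral_edge_weight_finite[OF vertex_cases(3)[OF kij]]
    by (simp add: ennreal_mult_less_top)
qed

lemma power_divide_power_le_inverse:
  fixes t s :: real
  assumes "0 \<le> t" "t \<le> s" "0 < s" "s \<le> 1" "f \<le> Suc e"
  shows "t ^ e / s ^ f \<le> inverse s"
proof -
  have "t ^ e * s \<le> s ^ e * s" using assms by (intro mult_right_mono power_mono) auto
  also have "\<dots> = s ^ Suc e" by simp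
  also have "\<dots> \<le> s ^ f" using assms by (intro power_decreasing) auto
  finally show ?thesis using assms by (simp add: field_simps)
qed

text \<open>
  Each factor of the integrand is at most \<open>1 / s\<^sub>j\<close> with \<open>s\<^sub>j = \<lambda>\<^sub>0 + \<lambda>\<^sub>j\<close>.  Since the barycentric coordinates
  sum to \<open>1\<close>, we have \<open>1 \<le> s\<^sub>1 + s\<^sub>2 + s\<^sub>3\<close>, and multiplying \<open>1 / (s\<^sub>1 s\<^sub>2 s\<^sub>3)\<close> by this sum cancels one
  of the three factors in each term.
\<close>

lemma moment_integrand_le_edge_weights:
  fixes \<alpha> \<gamma> :: "nat^3" and l :: "4 \<Rightarrow> real"
  assumes l: "\<And>i. 0 \<le> l i" "(\<Sum>i\<in>UNIV. l i) = 1"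
    and \<gamma>: "\<And>j. 1 \<le> \<gamma>$j" "\<And>j. \<gamma>$j \<le> Suc (\<alpha>$j)"
  shows "ennreal (moment_integrand \<alpha> \<gamma> l) \<le>
    edge_weight 2 3 l + edge_weight 1 3 l + edge_weight 1 2 l"
proof -
  define s where "s j = l 0 + l (vertex j)" for j
  have sum: "l 0 + l 1 + l 2 + l 3 = 1"
  proof -
    \<comment> \<open>In the four-element index type, \<open>4 = 0\<close>.\<close>
    have "l 4 = l 0" by (rule arg_cong[of _ _ l]) simp
    with l(2) show ?thesis unfolding sum_4 by linarith
  qed
  have s1: "s 1 = l 0 + l 1" "s 2 = l 0 + l 2" "s 3 = l 0 + l 3" by (simp_all add: s_def vertex_def)
  have mi: "moment_integrand \<alpha> \<gamma> l = (l 1 ^ (\<alpha>$1) / s 1 ^ (\<gamma>$1)) *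
      (l 2 ^ (\<alpha>$2) / s 2 ^ (\<gamma>$2)) * (l 3 ^ (\<alpha>$3) / s 3 ^ (\<gamma>$3))"
    unfolding moment_integrand_def s1 by simp
  note nn = l(1)[of 0] l(1)[of 1] l(1)[of 2] l(1)[of 3]
  show ?thesis
  proof (cases "s 1 > 0 \<and> s 2 > 0 \<and> s 3 > 0")
    case True
    then have pos: "s 1 > 0" "s 2 > 0" "s 3 > 0" by auto
    have "l 1 ^ (\<alpha>$1) / s 1 ^ (\<gamma>$1) \<le> inverse (s 1)" "l 2 ^ (\<alpha>$2) / s 2 ^ (\<gamma>$2) \<le> inverse (s 2)"
      "l 3 ^ (\<alpha>$3) / s 3 ^ (\<gamma>$3) \<le> inverse (s 3)"
      using pos nn sum by (auto intro!: power_divide_power_le_inverse \<gamma> simp: s1)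
    then have "moment_integrand \<alpha> \<gamma> l \<le> inverse (s 1) * inverse (s 2) * inverse (s 3)"
      unfolding mi using pos nn by (intro mult_mono mult_nonneg_nonneg) auto
    also have "\<dots> \<le> inverse (s 1) * inverse (s 2) * inverse (s 3) * (s 1 + s 2 + s 3)"
      (is "?P \<le> _")
    proof -
      have "0 \<le> ?P" using pos by simp
      moreover have "1 \<le> s 1 + s 2 + s 3" using nn sum by (simp add: s1)
      ultimately show ?thesis using mult_left_mono[of 1 "s 1 + s 2 + s 3" ?P] by simp
    qed
    also have "\<dots> = inverse (s 2 * s 3) + inverse (s 1 * s 3) + inverse (s 1 * s 2)"
      using pos by (simp add: field_simps)
    finally have "ennreal (moment_integrand \<alpha> \<gamma> l) \<le>
        ennreal (inverse (s 2 * s 3) + inverse (s 1 * s 3) + inverse (s 1 * s 2))"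
      by (rule ennreal_leI)
    then show ?thesis
      using pos by (simp add: edge_weight_def s1[symmetric] ennreal_plus)
  next
    case False
    \<comment> \<open>The integrand has the value \<open>0\<close> where its denominator vanishes, as \<open>\<gamma>\<^sub>j \<ge> 1\<close>.\<close>
    then have "s 1 = 0 \<or> s 2 = 0 \<or> s 3 = 0"
      using nn by (auto simp: s1)
    moreover have "\<gamma>$j \<noteq> 0" for j using \<gamma>(1)[of j] by simp
    ultimately have "moment_integrand \<alpha> \<gamma> l = 0"
      unfolding mi by auto
    then show ?thesis by simp
  qed
qed

lemma moment_finite:
  assumes v: "inj v" "\<not> affine_dependent (range v)"
    and \<gamma>: "\<And>j. 1 \<le> \<gamma>$j" "\<And>j. \<gamma>$j \<le> Suc (\<alpha>$j)"
  shows "moment v \<alpha> \<gamma> < \<infinity>"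
proof -
  have "moment v \<alpha> \<gamma> \<le> tetrahedron_mean v
      (\<lambda>l. edge_weight 2 3 l + edge_weight 1 3 l + edge_weight 1 2 l)"
    unfolding moment_eq_tetrahedron_mean
    using \<gamma> by (intro tetrahedron_mean_mono[OF v] moment_integrand_le_edge_weights)
  also have "\<dots> = tetrahedron_mean v (edge_weight 2 3) + tetrahedron_mean v (edge_weight 1 3)
      + tetrahedron_mean v (edge_weight 1 2)"
    by (simp add: tetrahedron_mean_add[OF v])
  also have "\<dots> < \<infinity>"
    using tetrahedron_mean_edge_weight_finite[OF v, of 1 2 3]
      tetrahedron_mean_edge_weight_finite[OF v, of 2 1 3]
      tetrahedron_mean_edge_weight_finite[OF v, of 3 1 2]
    by (simp add: vertex_def)
  finally show ?thesis .
qed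

section \<open>Infinite moments\<close>

lemma nn_integral_inverse_infinite:
  fixes c :: real
  assumes "c > 0"
  shows "(\<integral>\<^sup>+x\<in>{0<..c}. ennreal (1 / x) \<partial>lborel) = \<infinity>"
proof (rule ccontr)
  let ?I = "\<integral>\<^sup>+x\<in>{0<..c}. ennreal (1 / x) \<partial>lborel"
  assume "?I \<noteq> \<infinity>"
  then obtain n where n: "?I < of_nat n"
    using ennreal_Ex_less_of_nat by (auto simp: top.not_eq_extremum)
  \<comment> \<open>Chosen such that the integral from \<open>d\<close> to \<open>c\<close> is exactly \<open>n\<close>.\<close>
  define d where "d = c * exp (- real n)"
  have d: "0 < d" "d \<le> c"
    using assms by (auto simp: d_def mult_le_cancel_left1)
  have "(\<integral>\<^sup>+x. ennreal (1 / x) * indicator {d..c} x \<partial>lborel) = ln c - ln d"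
    using d by (intro nn_integral_FTC_Icc) (auto intro!: derivative_eq_intros)
  also have "ln c - ln d = real n"
    using assms by (simp add: d_def ln_mult)
  finally have "of_nat n = (\<integral>\<^sup>+x. ennreal (1 / x) * indicator {d..c} x \<partial>lborel)"
    by (simp add: ennreal_of_nat_eq_real_of_nat)
  also have "\<dots> \<le> ?I"
    using d by (intro nn_integral_mono) (auto simp: indicator_def)
  finally show False using n by simp
qed

text \<open>
  In this region, a wedge close to the edge \<open>\<lambda>\<^sub>0 = \<lambda>\<^sub>i = 0\<close> and away from its end points, \<open>\<lambda>\<^sub>k\<close> and
  \<open>\<lambda>\<^sub>j\<close> stay above \<open>1/4\<close>, and \<open>\<lambda>\<^sub>0\<close> and \<open>\<lambda>\<^sub>i\<close> are comparable.
\<close>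

lemma moment_integrand_lower_bound:
  fixes \<alpha> \<gamma> :: "nat^3"
  assumes kij: "distinct [k, i, j]" and \<gamma>: "Suc (Suc (\<alpha>$i)) \<le> \<gamma>$i"
    and x: "0 < x" "x \<le> 1/8" and y: "x \<le> y" "y \<le> 2*x" and z: "1/4 \<le> z" "z \<le> 1/3"
  shows "(1/4)^(\<alpha>$k) * (1/3)^(\<gamma>$i) * (1/4)^(\<alpha>$j) * (1 / x\<^sup>2)
    \<le> moment_integrand \<alpha> \<gamma> (simplex_point (vertex k) 0 (vertex i) (vertex j) x y z)"
proof -
  have frac: "(1/4) ^ e \<le> t ^ e / s ^ f" if "1/4 \<le> t" "0 < s" "s \<le> 1" for t s :: real and e f
  proof -
    have "(1/4) ^ e \<le> t ^ e" using that by (intro power_mono) auto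
    also have "\<dots> \<le> t ^ e / s ^ f"
      using that by (simp add: pos_le_divide_eq mult_left_le power_le_one)
    finally show ?thesis .
  qed
  have "(1/3)^(\<gamma>$i) * (1 / x\<^sup>2) \<le> y ^ (\<alpha>$i) / (x + y) ^ (\<gamma>$i)"
  proof -
    have "x ^ (\<gamma>$i) \<le> x ^ (\<alpha>$i + 2)"
      using x \<gamma> by (intro power_decreasing) auto
    then have "x ^ (\<gamma>$i) \<le> x ^ (\<alpha>$i) * x\<^sup>2"
      by (simp only: power_add)
    then have "1 / x\<^sup>2 \<le> x ^ (\<alpha>$i) / x ^ (\<gamma>$i)"
      using x by (simp add: field_simps)
    then have "(1/3)^(\<gamma>$i) * (1 / x\<^sup>2) \<le> (1/3)^(\<gamma>$i) * (x ^ (\<alpha>$i) / x ^ (\<gamma>$i))"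
      by (intro mult_left_mono) auto
    also have "\<dots> = x ^ (\<alpha>$i) / (3*x) ^ (\<gamma>$i)"
      by (simp add: power_mult_distrib power_divide)
    also have "\<dots> \<le> y ^ (\<alpha>$i) / (x + y) ^ (\<gamma>$i)"
      using x y by (intro frac_le power_mono zero_less_power) auto
    finally show ?thesis .
  qed
  moreover have "(1/4)^(\<alpha>$k) \<le> (1 - x - y - z) ^ (\<alpha>$k) / (1 - y - z) ^ (\<gamma>$k)"
    using x y z by (intro frac) auto
  moreover have "(1/4)^(\<alpha>$j) \<le> z ^ (\<alpha>$j) / (x + z) ^ (\<gamma>$j)"
    using x y z by (intro frac) auto
  ultimately have "(1/4)^(\<alpha>$k) * ((1/3)^(\<gamma>$i) * (1 / x\<^sup>2)) * (1/4)^(\<alpha>$j)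
    \<le> moment_integrand \<alpha> \<gamma> (simplex_point (vertex k) 0 (vertex i) (vertex j) x y z)"
    unfolding moment_integrand_simplex_point[OF kij]
    by (intro mult_mono') auto
  then show ?thesis by (simp only: mult_ac)
qed

text \<open>
  The wedge \<open>x \<le> y \<le> 2x\<close> has width \<open>x\<close>, so the lower bound \<open>1/x\<^sup>2\<close> of the integrand leaves the divergent
  integral of \<open>1/x\<close>.
\<close>

lemma moment_infinite:
  assumes v: "inj v" "\<not> affine_dependent (range v)" and \<gamma>: "Suc (Suc (\<alpha>$i)) \<le> \<gamma>$i"
  shows "moment v \<alpha> \<gamma> = \<infinity>"
proof -
  obtain k j where "distinct [i, k, j]"
    by (rule other_indices)
  then have kij: "distinct [k, i, j]" by auto
  let ?S = "simplex_integral (vertex k) 0 (vertex i) (vertex j) (\<lambda>l. ennreal (moment_integrand \<alpha> \<gamma> l))"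
  define C where "C = (1/4)^(\<alpha>$k) * (1/3)^(\<gamma>$i) * (1/4::real)^(\<alpha>$j)"
  have C: "C > 0" by (simp add: C_def)
  let ?h = "\<lambda>x y z. ennreal (C * (1 / x\<^sup>2)) * (indicator {0<..1/8} x * (indicator {x..2*x} y * indicator {1/4..1/3::real} z))
    :: ennreal"
  have "\<infinity> = ennreal (C / 12) * (\<integral>\<^sup>+x\<in>{0<..1/8}. ennreal (1 / x) \<partial>lborel)"
    using C by (subst nn_integral_inverse_infinite) (simp_all add: ennreal_mult_top)
  also have "\<dots> = (\<integral>\<^sup>+x. ennreal (C / 12) * (ennreal (1 / x) * indicator {0<..1/8} x) \<partial>lborel)"
    by (rule nn_integral_cmult[symmetric]) measurable
  also have "\<dots> = (\<integral>\<^sup>+x. \<integral>\<^sup>+y. \<integral>\<^sup>+z. ?h x y z \<partial>lborel \<partial>lborel \<partial>lborel)"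
  proof (rule nn_integral_cong)
    fix x :: real
    have "(\<integral>\<^sup>+y. \<integral>\<^sup>+z. ?h x y z \<partial>lborel \<partial>lborel) =
        ennreal (C * (1 / x\<^sup>2)) * (indicator {0<..1/8} x * (emeasure lborel {x..2*x} * ennreal (1/12)))"
      by (simp add: nn_integral_cmult nn_integral_multc)
    also have "\<dots> = ennreal (C / 12) * (ennreal (1 / x) * indicator {0<..1/8} x)"
      using C by (auto simp: indicator_def ennreal_mult'[symmetric] power2_eq_square)
    finally show "ennreal (C / 12) * (ennreal (1 / x) * indicator {0<..1/8} x) =
        (\<integral>\<^sup>+y. \<integral>\<^sup>+z. ?h x y z \<partial>lborel \<partial>lborel)" ..
  qed
  also have "\<dots> \<le> ?S"
    unfolding simplex_integral_def
  proof (intro nn_integral_mono)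
    fix x y z :: real
    show "?h x y z \<le> ennreal (moment_integrand \<alpha> \<gamma> (simplex_point (vertex k) 0 (vertex i) (vertex j) x y z))
        * indicator unit_simplex (x, y, z)"
    proof (cases "x \<in> {0<..1/8} \<and> y \<in> {x..2*x} \<and> z \<in> {1/4..1/3}")
      case True
      then have "(x, y, z) \<in> unit_simplex" by (auto simp: unit_simplex_def)
      then show ?thesis
        using True moment_integrand_lower_bound[OF kij \<gamma>, of x y z]
        by (simp add: C_def ennreal_leI)
    qed (auto simp: indicator_def)
  qed
  finally have "?S = \<infinity>" by (simp add: top_unique)
  moreover obtain c :: ennreal where c: "0 < c" and mean: "\<And>G. G \<in> borel_measurable borel \<Longrightarrow>
      tetrahedron_mean v G = c * simplex_integral (vertex k) 0 (vertex i) (vertex j) G"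
    using tetrahedron_mean_eq_simplex_integral[OF v vertex_cases(3,2)[OF kij]] by blast
  ultimately show ?thesis
    by (simp add: moment_eq_tetrahedron_mean mean ennreal_mult_eq_top_iff)
qed

section \<open>The recursion\<close>

text \<open>
  All terms are nonnegative and stand on the side where they are added, so the identity also yields the
  finiteness of one moment from that of another.
\<close>

lemma moment_by_parts:
  assumes v: "inj v" "\<not> affine_dependent (range v)"
    and \<gamma>: "\<And>j. \<gamma>$j \<le> Suc (\<alpha>$j)" and k: "\<alpha>$k > 0" and D: "0 \<le> delta_sum \<alpha> \<gamma>"
  shows "ennreal (real_of_int (delta_sum \<alpha> \<gamma>)) * moment v \<alpha> \<gamma>
      + ennreal (real (\<gamma>$k)) * moment v \<alpha> (\<gamma> + axis k 1)
    = ennreal (real (\<alpha>$k)) * moment v (\<alpha> - axis k 1) \<gamma>"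
proof -
  obtain i j where kij: "distinct [k, i, j]"
    by (rule other_indices)
  let ?I = "simplex_integral (vertex k) 0 (vertex i) (vertex j)"
  let ?D = "ennreal (real_of_int (delta_sum \<alpha> \<gamma>))"
  let ?M = "\<lambda>\<alpha> \<gamma> l. ennreal (moment_integrand \<alpha> \<gamma> l)"
  let ?G = "\<lambda>l. ?D * ?M \<alpha> \<gamma> l + ennreal (real (\<gamma>$k)) * ?M \<alpha> (\<gamma> + axis k 1) l"
  let ?H = "\<lambda>l. ennreal (real (\<alpha>$k)) * ?M (\<alpha> - axis k 1) \<gamma> l"
  have "(\<Sum>j\<in>UNIV. delta \<alpha> \<gamma> $ j) = delta \<alpha> \<gamma> $ k + (delta \<alpha> \<gamma> $ i + delta \<alpha> \<gamma> $ j)"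
    unfolding vertex_cases(1)[OF kij] using kij by simp
  then have "real_of_int (delta_sum \<alpha> \<gamma>) =
      real (Suc (\<alpha>$i) - \<gamma>$i + (Suc (\<alpha>$j) - \<gamma>$j)) + 1 + real (\<alpha>$k) - real (\<gamma>$k)"
    using \<gamma>[of i] \<gamma>[of j] by (simp add: delta_sum_def delta_def of_nat_diff)
  then have parts: "?I ?G = ?I ?H"
    using D by (intro simplex_integral_by_parts kij \<gamma> k) simp_all
  obtain c :: ennreal where mean: "\<And>G. G \<in> borel_measurable borel \<Longrightarrow> tetrahedron_mean v G = c * ?I G"
    using tetrahedron_mean_eq_simplex_integral[OF v vertex_cases(3,2)[OF kij]] by blast
  have "?D * moment v \<alpha> \<gamma> + ennreal (real (\<gamma>$k)) * moment v \<alpha> (\<gamma> + axis k 1) = tetrahedron_mean v ?G"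
    by (simp add: moment_eq_tetrahedron_mean tetrahedron_mean_add[OF v] tetrahedron_mean_cmult[OF v])
  also have "\<dots> = tetrahedron_mean v ?H"
    by (subst (1 2) mean) (simp_all only: parts, measurable)
  also have "\<dots> = ennreal (real (\<alpha>$k)) * moment v (\<alpha> - axis k 1) \<gamma>"
    by (simp add: moment_eq_tetrahedron_mean tetrahedron_mean_cmult[OF v])
  finally show ?thesis .
qed

theorem lemma4p10:
  fixes v :: "4 \<Rightarrow> real ^ 3" and \<alpha> \<gamma> :: "nat ^ 3" and k :: 3
  assumes "inj v" and "\<not> affine_dependent (range v)"
    and "moment v \<alpha> \<gamma> < \<infinity>"
    and "\<forall>j. \<gamma> $ j \<ge> 1"
    and "delta \<alpha> \<gamma> $ k > 0"
  shows "moment v (\<alpha> - axis k 1) \<gamma> < \<infinity> \<and>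
    moment v \<alpha> (\<gamma> + axis k 1) < \<infinity> \<and>
    enn2real (moment v \<alpha> \<gamma>) =
      real (\<alpha> $ k) / real_of_int (delta_sum \<alpha> \<gamma>) * enn2real (moment v (\<alpha> - axis k 1) \<gamma>) -
      real (\<gamma> $ k) / real_of_int (delta_sum \<alpha> \<gamma>) * enn2real (moment v \<alpha> (\<gamma> + axis k 1))"
proof -
  note v = assms(1,2)
  let ?D = "real_of_int (delta_sum \<alpha> \<gamma>)"
  let ?M0 = "moment v \<alpha> \<gamma>" and ?M1 = "moment v (\<alpha> - axis k 1) \<gamma>"
    and ?M2 = "moment v \<alpha> (\<gamma> + axis k 1)"
  have \<gamma>: "\<gamma>$j \<le> Suc (\<alpha>$j)" for j
    using moment_infinite[OF v, of \<alpha> j \<gamma>] assms(3) by (force simp: not_le Suc_le_eq)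
  have \<gamma>1: "1 \<le> \<gamma>$j" for j using assms(4) by simp
  have \<gamma>k: "\<gamma>$k \<le> \<alpha>$k" using assms(5) by (simp add: delta_def)
  have "\<alpha>$k > 0" using \<gamma>k \<gamma>1[of k] by simp
  have "0 \<le> delta \<alpha> \<gamma> $ j" for j using \<gamma>[of j] by (simp add: delta_def)
  then have D: "0 < delta_sum \<alpha> \<gamma>"
    using assms(5) unfolding delta_sum_def by (intro sum_pos2[of _ k]) simp_all
  \<comment> \<open>Lowering \<open>\<alpha>\<^sub>k\<close> keeps \<open>\<delta>\<^sub>k\<close> nonnegative, so the criterion applies to this moment too.\<close>
  have fin1: "?M1 < \<infinity>"
  proof (rule moment_finite[OF v \<gamma>1])
    show "\<gamma>$j \<le> Suc ((\<alpha> - axis k 1)$j)" for j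
      using \<gamma>[of j] \<gamma>k by (auto simp: axis_def)
  qed
  have id: "ennreal ?D * ?M0 + ennreal (real (\<gamma>$k)) * ?M2 = ennreal (real (\<alpha>$k)) * ?M1"
    using moment_by_parts[OF v \<gamma> \<open>\<alpha>$k > 0\<close>] D by simp
  have "ennreal (real (\<gamma>$k)) * ?M2 \<le> ennreal (real (\<alpha>$k)) * ?M1"
    unfolding id[symmetric] by simp
  also have "\<dots> < \<infinity>" using fin1 by (simp add: ennreal_mult_less_top)
  finally have fin2: "?M2 < \<infinity>"
    using \<gamma>1[of k] by (auto simp: ennreal_mult_less_top)
  obtain m0 m1 m2 where m: "?M0 = ennreal m0" "?M1 = ennreal m1" "?M2 = ennreal m2"
      "0 \<le> m0" "0 \<le> m1" "0 \<le> m2"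
    using assms(3) fin1 fin2
    by (cases ?M0; cases ?M1; cases ?M2) auto
  have "ennreal (?D * m0 + real (\<gamma>$k) * m2) = ennreal (real (\<alpha>$k) * m1)"
    using id m D by (simp add: ennreal_mult)
  then have "?D * m0 + real (\<gamma>$k) * m2 = real (\<alpha>$k) * m1"
    using m D by (subst (asm) ennreal_inj) auto
  then have "m0 = real (\<alpha>$k) / ?D * m1 - real (\<gamma>$k) / ?D * m2"
    using D by (simp add: field_simps)
  with m fin1 fin2 show ?thesis
    by simp
qed

end
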